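(* Let $\boldsymbol{\Sigma}$ be a set of sequents and let $\Gamma \rightarrow \Delta$ be a sequent. Then $\Gamma \rightarrow \Delta$ is derivable from $\boldsymbol{\Sigma}$ in the calculus $\mathrm{NMVL}_A$ if and only if $\boldsymbol{\Sigma}$ semantically entails $\Gamma \rightarrow \Delta$.
   Context: Fix a propositional language with a set of connectives, each connective $\ast$ having an arity $\ell$, and let $\mathcal{F}$ be its set of formulas. Fix truth values $V=\{v_1,\ldots,v_n\}$, $n\ge 2$. Each $\ell$-ary connective $\ast$ is given a non-deterministic truth table, i.e. a function $\ast: V^\ell \to P(V)\setminus\{\emptyset\}$. A valuation is a function $v:\mathcal{F}\to V$ such that for every connective $\ast$ and formulas $\varphi_1,\dots,\varphi_\ell$, $v(\ast(\varphi_1,\ldots,\varphi_\ell)) \in \ast(v(\varphi_1),\ldots,v(\varphi_\ell))$. A labelled formula is a pair $(\varphi,k)$ with $\varphi\in\mathcal{F}$ and $k\in\{1,\ldots,n\}$. A sequent is an expression $\Gamma\rightarrow\Delta$ where $\Gamma,\Delta$ are finite (possibly empty) sets of labelled formulas; commas denote union. For $K\subseteq\{1,\dots,n\}$, $\overline{K}=\{1,\ldots,n\}\setminus K$, and $\{\varphi\}\times K=\{(\varphi,k):k\in K\}$. The calculus $\mathrm{NMVL}_A$ has axioms: (i) $(\psi,k)\rightarrow(\psi,k)$ for every formula $\psi$ and $k=1,\ldots,n$; (ii) table axioms: for every connective $\ast$ of arity $\ell$, all formulas $\varphi_1,\ldots,\varphi_\ell$ and all $k_1,\ldots,k_\ell\in\{1,\ldots,n\}$,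 the sequent $(\varphi_1,k_1),\ldots,(\varphi_\ell,k_\ell)\rightarrow\{(\ast(\varphi_1,\ldots,\varphi_\ell),k): v_k\in\ast(v_{k_1},\ldots,v_{k_\ell})\}$. Its rules of inference are (for all finite sets $\Gamma,\Delta,\Delta',\Delta''$ of labelled formulas and formulas $\varphi$): - $k$-L-shift: from $\Gamma,(\varphi,k)\rightarrow\Delta$ infer $\Gamma\rightarrow\Delta,\{\varphi\}\times\overline{\{k\}}$; - $k',k''$-R-shift ($k'\ne k''$): from $\Gamma\rightarrow\Delta,(\varphi,k')$ infer $\Gamma,(\varphi,k'')\rightarrow\Delta$; - $k$-L-weakening: from $\Gamma\rightarrow\Delta$ infer $\Gamma,(\varphi,k)\rightarrow\Delta$; - $k$-R-weakening: from $\Gamma\rightarrow\Delta$ infer $\Gamma\rightarrow\Delta,(\varphi,k)$; - $k$-cut: from $\Gamma\rightarrow\Delta,(\varphi,k)$ and $\Gamma,(\varphi,k)\rightarrow\Delta$ infer $\Gamma\rightarrow\Delta$; - $k',k''$-resolution ($k'\neq k''$): from $\Gamma\rightarrow\Delta',(\varphi,k')$ and $\Gamma\rightarrow\Delta'',(\varphi,k'')$ infer $\Gamma\rightarrow\Delta',\Delta''$. A sequent is derivable from a set of sequents $\boldsymbol{\Sigma}$ if it has a derivation using the axioms, the members of $\boldsymbol{\Sigma}$ as additional initial sequents, and the rules. A valuation $v$ satisfies a sequent $\Gamma\rightarrow\Delta$ if, whenever $v(\varphi)=v_k$ for all $(\varphi,k)\in\Gamma$, there is some $(\varphi,k)\in\Delta$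 with $v(\varphi)=v_k$. A set of sequents $\boldsymbol{\Sigma}$ semantically entails a sequent $\Sigma$ if every valuation satisfying all sequents of $\boldsymbol{\Sigma}$ also satisfies $\Sigma$. *)

theory Defs
  imports Main "HOL-Library.FuncSet"
begin

text \<open>
  Formulas are the arity-respecting elements of this type whose connectives come from the
  given set; see \<open>formulas\<close> below. The type \<open>'p\<close> of propositional variables is arbitrary.
\<close>

datatype ('p, 'c) fm = Var 'p | Conn 'c "('p, 'c) fm list"

record ('c, 'v) nmatrix =
  connectives :: "'c set"
  arity :: "'c \<Rightarrow> nat"
  nvals :: nat
  val :: "nat \<Rightarrow> 'v"
  table :: "'c \<Rightarrow> 'v list \<Rightarrow> 'v set"

definition labels :: "('c, 'v) nmatrix \<Rightarrow> nat set" where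
  "labels M = {1..nvals M}"

definition truth_values :: "('c, 'v) nmatrix \<Rightarrow> 'v set" where
  "truth_values M = val M ` labels M"

locale nmatrix =
  fixes M :: "('c, 'v) nmatrix"
  assumes two_le_nvals: "2 \<le> nvals M"
    and val_inj: "inj_on (val M) (labels M)"
    and table_closed: "\<And>c xs. \<lbrakk>c \<in> connectives M; length xs = arity M c; set xs \<subseteq> truth_values M\<rbrakk>
      \<Longrightarrow> table M c xs \<subseteq> truth_values M"
    and table_nonempty: "\<And>c xs. \<lbrakk>c \<in> connectives M; length xs = arity M c; set xs \<subseteq> truth_values M\<rbrakk>
      \<Longrightarrow> table M c xs \<noteq> {}"

inductive_set formulas :: "('c, 'v) nmatrix \<Rightarrow> ('p, 'c) fm set" for M where
  Var: "Var p \<in> formulas M"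
| Conn: "\<lbrakk>c \<in> connectives M; length \<phi>s = arity M c; \<forall>\<phi>\<in>set \<phi>s. \<phi> \<in> formulas M\<rbrakk>
    \<Longrightarrow> Conn c \<phi>s \<in> formulas M"

text \<open>Values of a valuation outside \<open>formulas M\<close> are unconstrained and never consulted.\<close>

definition valuation :: "('c, 'v) nmatrix \<Rightarrow> (('p, 'c) fm \<Rightarrow> 'v) \<Rightarrow> bool" where
  "valuation M f \<longleftrightarrow> f \<in> formulas M \<rightarrow> truth_values M \<and>
     (\<forall>c\<in>connectives M. \<forall>\<phi>s. length \<phi>s = arity M c \<and> set \<phi>s \<subseteq> formulas M \<longrightarrow>
        f (Conn c \<phi>s) \<in> table M c (map f \<phi>s))"

type_synonym ('p, 'c) labelled = "('p, 'c) fm \<times> nat"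
type_synonym ('p, 'c) sequent = "('p, 'c) labelled set \<times> ('p, 'c) labelled set"

definition labelled_formulas :: "('c, 'v) nmatrix \<Rightarrow> ('p, 'c) labelled set" where
  "labelled_formulas M = formulas M \<times> labels M"

definition sequents :: "('c, 'v) nmatrix \<Rightarrow> ('p, 'c) sequent set" where
  "sequents M = Fpow (labelled_formulas M) \<times> Fpow (labelled_formulas M)"

definition satisfies ::
  "('c, 'v) nmatrix \<Rightarrow> (('p, 'c) fm \<Rightarrow> 'v) \<Rightarrow> ('p, 'c) sequent \<Rightarrow> bool" where
  "satisfies M f = (\<lambda>(\<Gamma>, \<Delta>).
     (\<forall>(\<phi>, k)\<in>\<Gamma>. f \<phi> = val M k) \<longrightarrow> (\<exists>(\<phi>, k)\<in>\<Delta>. f \<phi> = val M k))"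

definition entails ::
  "('c, 'v) nmatrix \<Rightarrow> ('p, 'c) sequent set \<Rightarrow> ('p, 'c) sequent \<Rightarrow> bool" where
  "entails M \<Sigma> S \<longleftrightarrow>
     (\<forall>f. valuation M f \<longrightarrow> (\<forall>S'\<in>\<Sigma>. satisfies M f S') \<longrightarrow> satisfies M f S)"

text \<open>
  Side conditions on formulas and labels appear only where they do not already follow from the
  premises being sequents; \<open>derivable_sequent\<close> below confirms that only sequents are derived.
\<close>

inductive derivable ::
  "('c, 'v) nmatrix \<Rightarrow> ('p, 'c) sequent set \<Rightarrow> ('p, 'c) sequent \<Rightarrow> bool"
  for M \<Sigma> where
  initial: "S \<in> \<Sigma> \<Longrightarrow> derivable M \<Sigma> S"
| identity: "\<lbrakk>\<psi> \<in> formulas M; k \<in> labels M\<rbrakk> \<Longrightarrow> derivable M \<Sigma> ({(\<psi>, k)}, {(\<psi>, k)})"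
| table_axiom: "\<lbrakk>c \<in> connectives M; length \<phi>s = arity M c; set \<phi>s \<subseteq> formulas M;
      length ks = arity M c; set ks \<subseteq> labels M\<rbrakk>
    \<Longrightarrow> derivable M \<Sigma> (set (zip \<phi>s ks),
          {(Conn c \<phi>s, k) | k. k \<in> labels M \<and> val M k \<in> table M c (map (val M) ks)})"
| L_shift: "derivable M \<Sigma> (\<Gamma> \<union> {(\<phi>, k)}, \<Delta>)
    \<Longrightarrow> derivable M \<Sigma> (\<Gamma>, \<Delta> \<union> {\<phi>} \<times> (labels M - {k}))"
| R_shift: "\<lbrakk>derivable M \<Sigma> (\<Gamma>, \<Delta> \<union> {(\<phi>, k')}); k'' \<in> labels M; k' \<noteq> k''\<rbrakk>
    \<Longrightarrow> derivable M \<Sigma> (\<Gamma> \<union> {(\<phi>, k'')}, \<Delta>)"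
| L_weakening: "\<lbrakk>derivable M \<Sigma> (\<Gamma>, \<Delta>); \<phi> \<in> formulas M; k \<in> labels M\<rbrakk>
    \<Longrightarrow> derivable M \<Sigma> (\<Gamma> \<union> {(\<phi>, k)}, \<Delta>)"
| R_weakening: "\<lbrakk>derivable M \<Sigma> (\<Gamma>, \<Delta>); \<phi> \<in> formulas M; k \<in> labels M\<rbrakk>
    \<Longrightarrow> derivable M \<Sigma> (\<Gamma>, \<Delta> \<union> {(\<phi>, k)})"
| cut: "\<lbrakk>derivable M \<Sigma> (\<Gamma>, \<Delta> \<union> {(\<phi>, k)}); derivable M \<Sigma> (\<Gamma> \<union> {(\<phi>, k)}, \<Delta>)\<rbrakk>
    \<Longrightarrow> derivable M \<Sigma> (\<Gamma>, \<Delta>)"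
| resolution: "\<lbrakk>derivable M \<Sigma> (\<Gamma>, \<Delta>' \<union> {(\<phi>, k')}); derivable M \<Sigma> (\<Gamma>, \<Delta>'' \<union> {(\<phi>, k'')}); k' \<noteq> k''\<rbrakk>
    \<Longrightarrow> derivable M \<Sigma> (\<Gamma>, \<Delta>' \<union> \<Delta>'')"

lemma derivable_sequent:
  assumes "\<Sigma> \<subseteq> sequents M" and "derivable M \<Sigma> S"
  shows "S \<in> sequents M"
  using assms(2)
proof (induction rule: derivable.induct)
  case (initial S)
  then show ?case using assms(1) by blast
next
  case (table_axiom c \<phi>s ks)
  have "Conn c \<phi>s \<in> formulas M"
    using table_axiom by (auto intro: formulas.Conn)
  moreover have "finite {(Conn c \<phi>s, k) | k. k \<in> labels M \<and> val M k \<in> table M c (map (val M) ks)}"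
    by (rule finite_subset[of _ "{Conn c \<phi>s} \<times> labels M"]) (auto simp: labels_def)
  ultimately show ?case
    using table_axiom
    by (auto simp: sequents_def labelled_formulas_def Fpow_def dest: set_zip_leftD set_zip_rightD)
qed (auto simp: sequents_def labelled_formulas_def Fpow_def labels_def)

end

theory Submission
  imports Defs
begin

text \<open>
  Completeness follows Henkin's method. If \<open>\<Gamma> \<rightarrow> \<Delta>\<close> is not derivable, Zorn's lemma extends \<open>\<Gamma>\<close>
  to a set \<open>T\<close> of labelled formulas that is maximal among those with no finite subset \<open>F\<close> for
  which \<open>F \<rightarrow> \<Delta>\<close> is derivable. By cut, \<open>T\<close> meets the right side of every derivable sequent whose
  left side it contains. Applied to the sequents \<open>\<rightarrow> {\<phi>} \<times> {1..n}\<close> and \<open>(\<phi>, k), (\<phi>, k') \<rightarrow>\<close>, which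
  the shift rules yield, this shows that \<open>T\<close> contains exactly one \<open>(\<phi>, k)\<close> for each formula \<open>\<phi>\<close>. The
  resulting function is a valuation by the table axioms, and it satisfies \<open>\<Sigma>\<close> but not \<open>\<Gamma> \<rightarrow> \<Delta>\<close>.
\<close>

section \<open>Soundness\<close>

lemma (in nmatrix) valuation_val:
  assumes "valuation M f" and "\<phi> \<in> formulas M"
  shows "\<exists>k\<in>labels M. f \<phi> = val M k"
  using assms by (auto simp: valuation_def truth_values_def)

lemma (in nmatrix) val_eq_iff:
  "k \<in> labels M \<Longrightarrow> k' \<in> labels M \<Longrightarrow> val M k = val M k' \<longleftrightarrow> k = k'"
  using val_inj by (auto dest: inj_onD)

lemma satisfies_iff:
  "satisfies M f (\<Gamma>, \<Delta>) \<longleftrightarrow>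
     (\<forall>\<phi> k. (\<phi>, k) \<in> \<Gamma> \<longrightarrow> f \<phi> = val M k) \<longrightarrow> (\<exists>\<phi> k. (\<phi>, k) \<in> \<Delta> \<and> f \<phi> = val M k)"
  unfolding satisfies_def by auto

text \<open>The left side forces the argument values to be those named by \<open>ks\<close>, so the
  value of the compound lies in that table entry. Being a truth value, it has a label, which then
  occurs on the right side.\<close>

lemma (in nmatrix) table_axiom_sound:
  assumes f: "valuation M f"
    and c: "c \<in> connectives M" "length \<phi>s = arity M c" "set \<phi>s \<subseteq> formulas M"
    and ks: "length ks = arity M c"
  shows "satisfies M f (set (zip \<phi>s ks),
          {(Conn c \<phi>s, k) | k. k \<in> labels M \<and> val M k \<in> table M c (map (val M) ks)})"
  unfolding satisfies_iff
proof
  assume *: "\<forall>\<phi> k. (\<phi>, k) \<in> set (zip \<phi>s ks) \<longrightarrow> f \<phi> = val M k"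
  have "map f \<phi>s = map (val M) ks"
    using * c ks by (intro nth_equalityI) (auto simp: set_zip)
  then have "f (Conn c \<phi>s) \<in> table M c (map (val M) ks)"
    using f c unfolding valuation_def by metis
  moreover have "Conn c \<phi>s \<in> formulas M"
    using c by (auto intro: formulas.Conn)
  then obtain k where "k \<in> labels M" "f (Conn c \<phi>s) = val M k"
    using f valuation_val by blast
  ultimately show "\<exists>\<phi> k. (\<phi>, k) \<in> {(Conn c \<phi>s, k) | k. k \<in> labels M \<and>
      val M k \<in> table M c (map (val M) ks)} \<and> f \<phi> = val M k"
    by auto
qed

text \<open>L-shift is sound because every formula takes one of the listed values; R-shift and
  resolution are sound because distinct labels name distinct values.\<close>

lemma (in nmatrix) soundness:
  assumes "\<Sigma> \<subseteq> sequents M" and "derivable M \<Sigma> S"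
    and f: "valuation M f" and "\<forall>S'\<in>\<Sigma>. satisfies M f S'"
  shows "satisfies M f S"
  using assms(2)
proof (induction rule: derivable.induct)
  case (initial S)
  then show ?case using assms(4) by blast
next
  case (table_axiom c \<phi>s ks)
  then show ?case using table_axiom_sound[OF f] by blast
next
  case (L_shift \<Gamma> \<phi> k \<Delta>)
  from derivable_sequent[OF assms(1) L_shift.hyps] have "\<phi> \<in> formulas M"
    by (auto simp: sequents_def labelled_formulas_def Fpow_def)
  then obtain k' where "k' \<in> labels M" "f \<phi> = val M k'"
    using f valuation_val by blast
  with L_shift.IH show ?case unfolding satisfies_iff by auto
next
  case (R_shift \<Gamma> \<Delta> \<phi> k' k'')
  \<comment> \<open>Injectivity of \<open>val M\<close> is available only on
    \<open>labels M\<close>; for \<open>k'\<close> membership comes from the premise being a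
    sequent.\<close>
  from derivable_sequent[OF assms(1) R_shift.hyps(1)] have "k' \<in> labels M"
    by (auto simp: sequents_def labelled_formulas_def Fpow_def)
  then have "val M k' \<noteq> val M k''"
    using R_shift.hyps val_eq_iff by blast
  with R_shift.IH show ?case unfolding satisfies_iff by fastforce
next
  case (resolution \<Gamma> \<Delta>' \<phi> k' \<Delta>'' k'')
  from derivable_sequent[OF assms(1) resolution.hyps(1)]
    derivable_sequent[OF assms(1) resolution.hyps(2)]
  have "k' \<in> labels M" "k'' \<in> labels M"
    by (auto simp: sequents_def labelled_formulas_def Fpow_def)
  then have "val M k' \<noteq> val M k''"
    using resolution.hyps val_eq_iff by blast
  with resolution.IH show ?case unfolding satisfies_iff by fastforce
qed (unfold satisfies_iff, blast+)

section \<open>Weakening and cut for finite sets\<close>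

lemma weakening:
  assumes d: "derivable M \<Sigma> (\<Gamma>, \<Delta>)" and sub: "\<Gamma> \<subseteq> \<Gamma>'" "\<Delta> \<subseteq> \<Delta>'"
    and seq: "(\<Gamma>', \<Delta>') \<in> sequents M"
  shows "derivable M \<Sigma> (\<Gamma>', \<Delta>')"
proof -
  have fin: "finite \<Gamma>'" "finite \<Delta>'"
    and lab: "\<Gamma>' \<subseteq> labelled_formulas M" "\<Delta>' \<subseteq> labelled_formulas M"
    using seq by (auto simp: sequents_def Fpow_def)
  have left: "derivable M \<Sigma> (\<Gamma> \<union> A, \<Delta>)"
    if "finite A" "A \<subseteq> labelled_formulas M" for A
    using that
  proof (induction A rule: finite_induct)
    case (insert x A)
    then show ?case
      using L_weakening[of M \<Sigma> "\<Gamma> \<union> A" \<Delta> "fst x" "snd x"]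
      by (auto simp: labelled_formulas_def)
  qed (simp add: d)
  have "derivable M \<Sigma> (\<Gamma> \<union> \<Gamma>', \<Delta> \<union> A)"
    if "finite A" "A \<subseteq> labelled_formulas M" for A
    using that
  proof (induction A rule: finite_induct)
    case (insert x A)
    then show ?case
      using R_weakening[of M \<Sigma> "\<Gamma> \<union> \<Gamma>'" "\<Delta> \<union> A" "fst x" "snd x"]
      by (auto simp: labelled_formulas_def)
  qed (simp add: left fin lab)
  from this[OF fin(2) lab(2)] show ?thesis
    using sub by (simp add: Un_absorb1)
qed

text \<open>The members of \<open>A\<close> are cut away one at a time. Cut needs equal contexts, so
  the premise for \<open>x\<close> is first weakened on the right by the members of \<open>A\<close>
  still to be removed.\<close>

lemma multicut:
  assumes "finite A" and "derivable M \<Sigma> (\<Gamma>, A \<union> \<Delta>)"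
    and "\<And>x. x \<in> A \<Longrightarrow> derivable M \<Sigma> (insert x \<Gamma>, \<Delta>)"
    and \<Gamma>: "\<Gamma> \<subseteq> labelled_formulas M" "finite \<Gamma>"
    and \<Delta>: "\<Delta> \<subseteq> labelled_formulas M" "finite \<Delta>"
    and "A \<subseteq> labelled_formulas M"
  shows "derivable M \<Sigma> (\<Gamma>, \<Delta>)"
  using assms(1-3,8)
proof (induction A rule: finite_induct)
  case (insert x A)
  have "derivable M \<Sigma> (insert x \<Gamma>, A \<union> \<Delta>)"
    by (rule weakening[OF insert.prems(2)[of x]])
      (use insert.prems insert.hyps \<Gamma> \<Delta> in \<open>auto simp: sequents_def Fpow_def\<close>)
  then have "derivable M \<Sigma> (\<Gamma>, A \<union> \<Delta>)"
    using cut[of M \<Sigma> \<Gamma> "A \<union> \<Delta>" "fst x" "snd x"] insert.prems(1) by simp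
  with insert show ?case by simp
qed simp

section \<open>Saturated sets\<close>

text \<open>With membership of \<open>(\<phi>, k)\<close> read as "\<open>\<phi>\<close> has value
  \<open>val M k\<close>", every derivable sequent is true. Consistency is included: if the right
  side is empty, the left side cannot lie in \<open>T\<close>.\<close>

definition saturated ::
  "('c, 'v) nmatrix \<Rightarrow> ('p, 'c) sequent set \<Rightarrow> ('p, 'c) labelled set \<Rightarrow> bool" where
  "saturated M \<Sigma> T \<longleftrightarrow> T \<subseteq> labelled_formulas M \<and>
     (\<forall>\<Gamma> \<Delta>. derivable M \<Sigma> (\<Gamma>, \<Delta>) \<longrightarrow> \<Gamma> \<subseteq> T \<longrightarrow> \<Delta> \<inter> T \<noteq> {})"

text \<open>A Lindenbaum lemma. \<open>T\<close> may be infinite, while left sides of sequents are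
  finite; quantifying over finite subsets also makes the condition pass to unions of chains.\<close>

lemma saturated_extension:
  assumes \<Sigma>: "\<Sigma> \<subseteq> sequents M" and seq: "(\<Gamma>, \<Delta>) \<in> sequents M"
    and nd: "\<not> derivable M \<Sigma> (\<Gamma>, \<Delta>)"
  shows "\<exists>T. saturated M \<Sigma> T \<and> \<Gamma> \<subseteq> T \<and> \<Delta> \<inter> T = {}"
proof -
  define \<A> where "\<A> = {T. \<Gamma> \<subseteq> T \<and> T \<subseteq> labelled_formulas M \<and>
      (\<forall>F\<subseteq>T. finite F \<longrightarrow> \<not> derivable M \<Sigma> (F, \<Delta>))}"
  have \<Delta>: "finite \<Delta>" "\<Delta> \<subseteq> labelled_formulas M" and \<Gamma>: "\<Gamma> \<subseteq> labelled_formulas M"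
    using seq by (auto simp: sequents_def Fpow_def)
  \<comment> \<open>A derivation from a subset of \<open>\<Gamma>\<close> would weaken to one of the
    given sequent.\<close>
  have "\<Gamma> \<in> \<A>"
    using nd \<Gamma> weakening[OF _ _ subset_refl seq] unfolding \<A>_def by blast
  have chain: "\<Union>C \<in> \<A>" if C: "C \<noteq> {}" "subset.chain \<A> C" for C
  proof -
    have CA: "C \<subseteq> \<A>"
      using C(2) by (auto simp: subset.chain_def)
    have "\<not> derivable M \<Sigma> (F, \<Delta>)" if F: "F \<subseteq> \<Union>C" "finite F" for F
    proof -
      obtain T where "T \<in> C" "F \<subseteq> T"
        using finite_subset_Union_chain[OF F(2,1) C] by blast
      with CA F(2) show ?thesis by (auto simp: \<A>_def)
    qed
    moreover have "\<Gamma> \<subseteq> \<Union>C" "\<Union>C \<subseteq> labelled_formulas M"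
      using C(1) CA unfolding \<A>_def by blast+
    ultimately show ?thesis unfolding \<A>_def by blast
  qed
  obtain T where T: "T \<in> \<A>" and max: "\<And>X. X \<in> \<A> \<Longrightarrow> T \<subseteq> X \<Longrightarrow> X = T"
    using subset_Zorn_nonempty[of \<A>] \<open>\<Gamma> \<in> \<A>\<close> chain by blast
  have TL: "T \<subseteq> labelled_formulas M" and "\<Gamma> \<subseteq> T"
    and Tnd: "\<And>F. F \<subseteq> T \<Longrightarrow> finite F \<Longrightarrow> \<not> derivable M \<Sigma> (F, \<Delta>)"
    using T by (auto simp: \<A>_def)
  have outside: "\<exists>F\<subseteq>T. finite F \<and> derivable M \<Sigma> (insert x F, \<Delta>)"
    if x: "x \<in> labelled_formulas M" "x \<notin> T" for x
  proof -
    have "insert x T \<notin> \<A>"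
      using max[of "insert x T"] x(2) by blast
    then obtain G where G: "G \<subseteq> insert x T" "finite G" "derivable M \<Sigma> (G, \<Delta>)"
      using x(1) TL \<open>\<Gamma> \<subseteq> T\<close> by (auto simp: \<A>_def)
    \<comment> \<open>Weakening avoids a case distinction on whether \<open>x\<close> is in
      \<open>G\<close>.\<close>
    have "derivable M \<Sigma> (insert x (G - {x}), \<Delta>)"
      by (rule weakening[OF G(3)])
        (use G x TL \<Delta> in \<open>auto simp: sequents_def Fpow_def\<close>)
    with G show ?thesis by (intro exI[of _ "G - {x}"]) auto
  qed
  have "\<Delta>' \<inter> T \<noteq> {}" if d: "derivable M \<Sigma> (\<Gamma>', \<Delta>')" and sub: "\<Gamma>' \<subseteq> T" for \<Gamma>' \<Delta>'
  proof
    assume disj: "\<Delta>' \<inter> T = {}"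
    have fin: "finite \<Gamma>'" "finite \<Delta>'" and \<Delta>': "\<Delta>' \<subseteq> labelled_formulas M"
      using derivable_sequent[OF \<Sigma> d] by (auto simp: sequents_def Fpow_def)
    have "\<forall>x\<in>\<Delta>'. \<exists>F. F \<subseteq> T \<and> finite F \<and> derivable M \<Sigma> (insert x F, \<Delta>)"
      using outside disj \<Delta>' by blast
    then obtain F where F: "\<And>x. x \<in> \<Delta>' \<Longrightarrow>
        F x \<subseteq> T \<and> finite (F x) \<and> derivable M \<Sigma> (insert x (F x), \<Delta>)"
      by metis
    \<comment> \<open>The finitely many witnesses are merged with \<open>\<Gamma>'\<close> into one
      finite left side, so that all the cuts share a context inside \<open>T\<close>.\<close>
    define G where "G = \<Gamma>' \<union> (\<Union>x\<in>\<Delta>'. F x)"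
    have G: "G \<subseteq> T" "finite G"
      using F fin sub by (auto simp: G_def)
    have "derivable M \<Sigma> (G, \<Delta>)"
    proof (rule multicut[OF fin(2)])
      show "derivable M \<Sigma> (G, \<Delta>' \<union> \<Delta>)"
        by (rule weakening[OF d])
          (use G TL fin \<Delta> \<Delta>' in \<open>auto simp: G_def sequents_def Fpow_def\<close>)
      show "derivable M \<Sigma> (insert x G, \<Delta>)" if "x \<in> \<Delta>'" for x
      proof (rule weakening)
        show "derivable M \<Sigma> (insert x (F x), \<Delta>)"
          using F that by blast
        show "insert x (F x) \<subseteq> insert x G"
          using that by (auto simp: G_def)
        show "(insert x G, \<Delta>) \<in> sequents M"
          using G TL \<Delta> \<Delta>' that by (auto simp: sequents_def Fpow_def)
      qed simp
    qed (use G TL \<Delta> \<Delta>' in auto)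
    with Tnd G show False by blast
  qed
  \<comment> \<open>A common element would make an identity axiom weaken to a derivable sequent that
    \<open>T\<close> excludes.\<close>
  moreover have "\<Delta> \<inter> T = {}"
  proof (rule ccontr)
    assume "\<Delta> \<inter> T \<noteq> {}"
    then obtain \<phi> k where k: "(\<phi>, k) \<in> \<Delta>" "(\<phi>, k) \<in> T"
      by fastforce
    then have lab: "\<phi> \<in> formulas M" "k \<in> labels M"
      using TL by (auto simp: labelled_formulas_def)
    have "derivable M \<Sigma> ({(\<phi>, k)}, \<Delta>)"
      by (rule weakening[OF identity[OF lab]])
        (use k \<Delta> lab in \<open>auto simp: sequents_def Fpow_def labelled_formulas_def\<close>)
    with Tnd[of "{(\<phi>, k)}"] k show False by simp
  qed
  ultimately show ?thesis
    using TL \<open>\<Gamma> \<subseteq> T\<close> unfolding saturated_def by blast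
qed

section \<open>The valuation of a saturated set\<close>

lemma (in nmatrix) saturated_ex1:
  assumes T: "saturated M \<Sigma> T" and \<phi>: "\<phi> \<in> formulas M"
  shows "\<exists>!k. (\<phi>, k) \<in> T"
proof -
  have ref: "\<Delta>' \<inter> T \<noteq> {}" if "derivable M \<Sigma> (\<Gamma>', \<Delta>')" "\<Gamma>' \<subseteq> T" for \<Gamma>' \<Delta>'
    using T that by (auto simp: saturated_def)
  have one: "1 \<in> labels M"
    using two_le_nvals by (auto simp: labels_def)
  \<comment> \<open>L-shift of the identity axiom for label 1 lists all labels on the right; any
    other label would serve equally.\<close>
  have "derivable M \<Sigma> ({}, {(\<phi>, 1)} \<union> {\<phi>} \<times> (labels M - {1}))"
    by (rule L_shift) (simp add: identity \<phi> one del: One_nat_def)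
  from ref[OF this] obtain k where k: "(\<phi>, k) \<in> T"
    by auto
  have "k' = k''" if "(\<phi>, k') \<in> T" "(\<phi>, k'') \<in> T" for k' k''
  proof (rule ccontr)
    assume "k' \<noteq> k''"
    have "k' \<in> labels M" "k'' \<in> labels M"
      using that T by (auto simp: saturated_def labelled_formulas_def)
    then have "derivable M \<Sigma> ({(\<phi>, k')} \<union> {(\<phi>, k'')}, {})"
      using identity[OF \<phi>, of k'] \<open>k' \<noteq> k''\<close> by (intro R_shift) auto
    from ref[OF this] that show False by simp
  qed
  with k show ?thesis by blast
qed

lemma (in nmatrix) saturated_valuation:
  assumes T: "saturated M \<Sigma> T"
  shows "\<exists>f. valuation M f \<and>
    (\<forall>\<phi> k. \<phi> \<in> formulas M \<longrightarrow> k \<in> labels M \<longrightarrow> (f \<phi> = val M k \<longleftrightarrow> (\<phi>, k) \<in> T))"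
proof -
  have TL: "T \<subseteq> formulas M \<times> labels M"
    and ref: "\<And>\<Gamma>' \<Delta>'. derivable M \<Sigma> (\<Gamma>', \<Delta>') \<Longrightarrow> \<Gamma>' \<subseteq> T \<Longrightarrow> \<Delta>' \<inter> T \<noteq> {}"
    using T by (auto simp: saturated_def labelled_formulas_def)
  \<comment> \<open>Well defined on formulas by uniqueness; its values elsewhere are
    irrelevant.\<close>
  define lab where "lab \<phi> = (THE k. (\<phi>, k) \<in> T)" for \<phi>
  have lab: "(\<phi>, k) \<in> T \<longleftrightarrow> k = lab \<phi>" if "\<phi> \<in> formulas M" for \<phi> k
    using saturated_ex1[OF T that] theI'[OF saturated_ex1[OF T that]] unfolding lab_def by blast
  have lab_labels: "lab \<phi> \<in> labels M" if "\<phi> \<in> formulas M" for \<phi>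
    using lab[OF that] TL by auto
  define f where "f = (\<lambda>\<phi>. val M (lab \<phi>))"
  have "f (Conn c \<phi>s) \<in> table M c (map f \<phi>s)"
    if c: "c \<in> connectives M" "length \<phi>s = arity M c" "set \<phi>s \<subseteq> formulas M" for c \<phi>s
  proof -
    have "Conn c \<phi>s \<in> formulas M"
      using c by (auto intro: formulas.Conn)
    \<comment> \<open>The table axiom at the labels chosen by \<open>T\<close> has its left side in
      \<open>T\<close>. Saturation puts some admissible label of the compound into \<open>T\<close>,
      and by uniqueness it is the chosen one.\<close>
    have "derivable M \<Sigma> (set (zip \<phi>s (map lab \<phi>s)),
        {(Conn c \<phi>s, k) | k. k \<in> labels M \<and> val M k \<in> table M c (map (val M) (map lab \<phi>s))})"
      using c lab_labels by (intro table_axiom) auto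
    moreover have "set (zip \<phi>s (map lab \<phi>s)) \<subseteq> T"
      using c lab by (auto simp: set_zip subset_iff)
    ultimately obtain k where "(Conn c \<phi>s, k) \<in> T" "val M k \<in> table M c (map (val M) (map lab \<phi>s))"
      using ref by blast
    with lab[OF \<open>Conn c \<phi>s \<in> formulas M\<close>] show ?thesis
      by (simp add: f_def comp_def)
  qed
  then have "valuation M f"
    using lab_labels by (auto simp: valuation_def truth_values_def f_def)
  moreover have "f \<phi> = val M k \<longleftrightarrow> (\<phi>, k) \<in> T" if "\<phi> \<in> formulas M" "k \<in> labels M" for \<phi> k
    using lab[OF that(1)] val_eq_iff[OF lab_labels[OF that(1)] that(2)] by (auto simp: f_def)
  ultimately show ?thesis by blast
qed

section \<open>Completeness\<close>

lemma (in nmatrix) completeness: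
  assumes \<Sigma>: "\<Sigma> \<subseteq> sequents M" and seq: "(\<Gamma>, \<Delta>) \<in> sequents M"
    and ent: "entails M \<Sigma> (\<Gamma>, \<Delta>)"
  shows "derivable M \<Sigma> (\<Gamma>, \<Delta>)"
proof (rule ccontr)
  assume "\<not> derivable M \<Sigma> (\<Gamma>, \<Delta>)"
  then obtain T where T: "saturated M \<Sigma> T" "\<Gamma> \<subseteq> T" "\<Delta> \<inter> T = {}"
    using saturated_extension[OF \<Sigma> seq] by blast
  obtain f where f: "valuation M f"
    and fT: "\<And>\<phi> k. \<phi> \<in> formulas M \<Longrightarrow> k \<in> labels M \<Longrightarrow> f \<phi> = val M k \<longleftrightarrow> (\<phi>, k) \<in> T"
    using saturated_valuation[OF T(1)] by blast
  have sat: "satisfies M f (\<Gamma>', \<Delta>') \<longleftrightarrow> \<Gamma>' \<subseteq> T \<longrightarrow> \<Delta>' \<inter> T \<noteq> {}"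
    if "(\<Gamma>', \<Delta>') \<in> sequents M" for \<Gamma>' \<Delta>'
  proof -
    have "\<Gamma>' \<subseteq> formulas M \<times> labels M" "\<Delta>' \<subseteq> formulas M \<times> labels M"
      using that by (auto simp: sequents_def Fpow_def labelled_formulas_def)
    then have "(\<forall>\<phi> k. (\<phi>, k) \<in> \<Gamma>' \<longrightarrow> f \<phi> = val M k) \<longleftrightarrow> \<Gamma>' \<subseteq> T"
      and "(\<exists>\<phi> k. (\<phi>, k) \<in> \<Delta>' \<and> f \<phi> = val M k) \<longleftrightarrow> \<Delta>' \<inter> T \<noteq> {}"
      using fT by blast+
    then show ?thesis unfolding satisfies_iff by simp
  qed
  \<comment> \<open>Members of \<open>\<Sigma>\<close> are derivable as initial sequents, so
    saturation applies to them.\<close>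
  have "\<forall>S'\<in>\<Sigma>. satisfies M f S'"
    using \<Sigma> T(1) sat by (force simp: saturated_def intro: derivable.initial)
  with ent f have "satisfies M f (\<Gamma>, \<Delta>)"
    by (auto simp: entails_def)
  with sat[OF seq] T show False by blast
qed

theorem theorem1:
  fixes M :: "('c, 'v) nmatrix"
    and \<Sigma> :: "('p, 'c) sequent set"
    and \<Gamma> \<Delta> :: "('p, 'c) labelled set"
  assumes "nmatrix M"
    and "\<Sigma> \<subseteq> sequents M"
    and "(\<Gamma>, \<Delta>) \<in> sequents M"
  shows "derivable M \<Sigma> (\<Gamma>, \<Delta>) \<longleftrightarrow> entails M \<Sigma> (\<Gamma>, \<Delta>)"
proof -
  interpret nmatrix M by fact
  show ?thesis
    using soundness completeness assms(2,3) unfolding entails_def by blast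
qed

end
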